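(* Let $M=(V,E)$ be a trivalent plane graph embedded in $\mathbb{C}$ with complex coordinate $z$ (so each vertex $v_a\in V$ has a coordinate $z_a=z(v_a)\in\mathbb{C}$). Let $g:\mathbb{C}\to\mathbb{C}$ be holomorphic, write $g_a=g(z_a)$ and $dg(e_{ab})=g_b-g_a$, and let $q:E\to\mathbb{C}$ be a holomorphic quadratic differential on $M$ associated with $g$, with corresponding discrete $1$-form $\tau:E\to\mathbb{C}$. For each oriented edge $e_{ab}\in E$ from $v_a$ to $v_b$ define $$dF(e_{ab})=-\overline{\tau(e_{ab})}\,\bigl(1-g_ag_b,\ i(1+g_ag_b),\ g_a+g_b\bigr)\in\mathbb{C}^3,$$ which equals $\dfrac{i\,q(e_{ab})}{dg(e_{ab})}\bigl(1-g_ag_b,\ i(1+g_ag_b),\ g_a+g_b\bigr)$ when $dg(e_{ab})\neq 0$. Then $$X=\int \mathrm{Re}\, dF$$ defines a discrete harmonic surface in $\mathbb{R}^3$, where $X$ is the (possibly multivalued) map on $M$ with $dX(e_{ab})=X(v_b)-X(v_a)=\mathrm{Re}\, dF(e_{ab})$ for all $e_{ab}\in E$.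
   Context: A trivalent graph is a graph in which every vertex has exactly three neighbours. $E$ is the set of oriented edges: each edge joining $v_a$ and $v_b$ occurs as $e_{ab}$ (from $v_a$ to $v_b$) and as its reverse $e_{ba}$. For $v\in V$, $E_v$ is the set of the three oriented edges with origin $v$. A discrete $1$-form is a function $\tau:E\to\mathbb{C}$ with $\tau(e_{ab})=-\tau(e_{ba})$. Holomorphic quadratic differential associated with $g$: a function $q:E\to\mathbb{C}$ of the form $q(e)=i\,\overline{\tau(e)}\,dg(e)$, where $\tau$ is a discrete $1$-form, such that $$\sum_{e\in E_v}q(e)=0\quad\text{and}\quad\sum_{e\in E_v}\tau(e)=0\qquad\text{for all } v\in V.$$ Discrete harmonic surface: $X$ (with values in $\mathbb{R}^3$) is a harmonic realization, and its image is called a discrete harmonic surface, if it satisfies the balancing condition at every vertex: $\sum_{e\in E_v}dX(e)=0$ for all $v\in V$; that is, $(X_1-X_0)+(X_2-X_0)+(X_3-X_0)=0$, where $X_0=X(v)$ and $X_1,X_2,X_3$ are the values at the three neighbours of $v$. Integration and multivaluedness: the values of $X$ are obtained by summing $\mathrm{Re}\,dF$ along edge paths from a base vertex. If the sum of $\mathrm{Re}\,dF$ around every cycle of $M$ vanishes, $X$ is an ordinary map $V\to\mathbb{R}^3$, unique up to translation on each connected component. In general $X$ is multivalued on $M$, i.e. it is a map on the universal covering graph of $M$ (to which $\mathrm{Re}\,dF$ is lifted), and the balancing condition is understood there. *)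

theory Defs
  imports "HOL-Analysis.Analysis" "Graph_Theory.Graph_Theory"
begin

text \<open>
  A graph is given by its set of vertices and its set of oriented edges, as a digraph without
  parallel arcs; an unoriented edge occurs as the two arcs \<open>(a, b)\<close> and \<open>(b, a)\<close>. Thus
  \<open>parcs M\<close> is \<open>E\<close> and \<open>out_arcs M v\<close> is \<open>E\<^sub>v\<close>. Graphs may be infinite or disconnected.
\<close>

definition trivalent_graph :: "'v pair_pre_digraph \<Rightarrow> bool" where
  "trivalent_graph G \<longleftrightarrow>
     pair_bidirected_digraph G \<and> (\<forall>v\<in>pverts G. out_degree G v = 3)"

text \<open>
  \<open>\<gamma> e\<close> is the plane arc that draws the oriented edge \<open>e\<close>. Its interior
  \<open>\<gamma> e ` {0<..<1}\<close> meets no vertex and no other edge.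
\<close>

definition plane_embedding :: "'v pair_pre_digraph \<Rightarrow> ('v \<Rightarrow> complex) \<Rightarrow> bool" where
  "plane_embedding G z \<longleftrightarrow> inj_on z (pverts G) \<and>
     (\<exists>\<gamma> :: 'v \<times> 'v \<Rightarrow> real \<Rightarrow> complex.
        (\<forall>(a, b)\<in>parcs G.
           arc (\<gamma> (a, b)) \<and> pathstart (\<gamma> (a, b)) = z a \<and> pathfinish (\<gamma> (a, b)) = z b \<and>
           \<gamma> (b, a) = reversepath (\<gamma> (a, b)) \<and>
           \<gamma> (a, b) ` {0<..<1} \<inter> z ` pverts G = {}) \<and>
        (\<forall>e\<in>parcs G. \<forall>e'\<in>parcs G. e' \<noteq> e \<and> e' \<noteq> prod.swap e \<longrightarrow>
           \<gamma> e ` {0<..<1} \<inter> \<gamma> e' ` {0<..<1} = {}))"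

definition trivalent_plane_graph :: "'v pair_pre_digraph \<Rightarrow> ('v \<Rightarrow> complex) \<Rightarrow> bool" where
  "trivalent_plane_graph G z \<longleftrightarrow> trivalent_graph G \<and> plane_embedding G z"

definition discrete_one_form :: "'v pair_pre_digraph \<Rightarrow> ('v \<times> 'v \<Rightarrow> complex) \<Rightarrow> bool" where
  "discrete_one_form G \<tau> \<longleftrightarrow> (\<forall>(a, b)\<in>parcs G. \<tau> (a, b) = - \<tau> (b, a))"

definition dg :: "('v \<Rightarrow> complex) \<Rightarrow> (complex \<Rightarrow> complex) \<Rightarrow> 'v \<times> 'v \<Rightarrow> complex" where
  "dg z g = (\<lambda>(a, b). g (z b) - g (z a))"

text \<open>\<open>q\<close> is a holomorphic quadratic differential associated with \<open>g\<close>, and \<open>\<tau>\<close> is the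
  discrete 1-form in its representation.\<close>

definition holomorphic_quadratic_differential ::
    "'v pair_pre_digraph \<Rightarrow> ('v \<Rightarrow> complex) \<Rightarrow> (complex \<Rightarrow> complex) \<Rightarrow>
     ('v \<times> 'v \<Rightarrow> complex) \<Rightarrow> ('v \<times> 'v \<Rightarrow> complex) \<Rightarrow> bool" where
  "holomorphic_quadratic_differential G z g q \<tau> \<longleftrightarrow>
     discrete_one_form G \<tau> \<and>
     (\<forall>e\<in>parcs G. q e = \<i> * cnj (\<tau> e) * dg z g e) \<and>
     (\<forall>v\<in>pverts G. (\<Sum>e\<in>out_arcs G v. q e) = 0 \<and> (\<Sum>e\<in>out_arcs G v. \<tau> e) = 0)"

definition weierstrass_vector ::
    "('v \<Rightarrow> complex) \<Rightarrow> (complex \<Rightarrow> complex) \<Rightarrow> 'v \<times> 'v \<Rightarrow> complex ^ 3" where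
  "weierstrass_vector z g = (\<lambda>(a, b).
     vector [1 - g (z a) * g (z b), \<i> * (1 + g (z a) * g (z b)), g (z a) + g (z b)])"

definition dF ::
    "('v \<Rightarrow> complex) \<Rightarrow> (complex \<Rightarrow> complex) \<Rightarrow> ('v \<times> 'v \<Rightarrow> complex) \<Rightarrow>
     'v \<times> 'v \<Rightarrow> complex ^ 3" where
  "dF z g \<tau> e = (- cnj (\<tau> e)) *s weierstrass_vector z g e"

definition Re_vec :: "complex ^ 'n \<Rightarrow> real ^ 'n" where
  "Re_vec w = (\<chi> i. Re (w $ i))"

definition integrates ::
    "'v pair_pre_digraph \<Rightarrow> ('v \<times> 'v \<Rightarrow> real ^ 3) \<Rightarrow> ('v \<Rightarrow> real ^ 3) \<Rightarrow> bool" where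
  "integrates G \<omega> X \<longleftrightarrow> (\<forall>(a, b)\<in>parcs G. X b - X a = \<omega> (a, b))"

text \<open>The discrete harmonic surface is the image \<open>X ` pverts G\<close> of such a realization.\<close>

definition harmonic_realization :: "'v pair_pre_digraph \<Rightarrow> ('v \<Rightarrow> real ^ 3) \<Rightarrow> bool" where
  "harmonic_realization G X \<longleftrightarrow>
     trivalent_graph G \<and> (\<forall>v\<in>pverts G. (\<Sum>(a, b)\<in>out_arcs G v. X b - X a) = 0)"

text \<open>
  The universal covering graph of the component of \<open>v\<^sub>0\<close>: its vertices are the edge paths from
  \<open>v\<^sub>0\<close> without backtracking (the homotopy classes of edge paths from \<open>v\<^sub>0\<close>), written as lists of
  vertices, and two of them are adjacent if one extends the other by one edge. The covering
  projection sends a path to its end point \<open>last p\<close>.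
\<close>

definition reduced_paths :: "'v pair_pre_digraph \<Rightarrow> 'v \<Rightarrow> 'v list set" where
  "reduced_paths G v\<^sub>0 =
     {p. vwalk p (with_proj G) \<and> hd p = v\<^sub>0 \<and> (\<forall>i. i + 2 < length p \<longrightarrow> p ! i \<noteq> p ! (i + 2))}"

definition universal_cover :: "'v pair_pre_digraph \<Rightarrow> 'v \<Rightarrow> 'v list pair_pre_digraph" where
  "universal_cover G v\<^sub>0 =
     \<lparr> pverts = reduced_paths G v\<^sub>0,
       parcs = {(p, p'). p \<in> reduced_paths G v\<^sub>0 \<and> p' \<in> reduced_paths G v\<^sub>0 \<and>
                         ((\<exists>u. p' = p @ [u]) \<or> (\<exists>u. p = p' @ [u]))} \<rparr>"

definition lift_form :: "('v \<times> 'v \<Rightarrow> 'c) \<Rightarrow> 'v list \<times> 'v list \<Rightarrow> 'c" where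
  "lift_form \<omega> = (\<lambda>(p, p'). \<omega> (last p, last p'))"

lemma reduced_paths_snoc:
  assumes "pair_wf_digraph G" and "p \<noteq> []"
  shows "p @ [u] \<in> reduced_paths G v\<^sub>0 \<longleftrightarrow>
    p \<in> reduced_paths G v\<^sub>0 \<and> (last p, u) \<in> parcs G \<and>
    (length p \<ge> 2 \<longrightarrow> u \<noteq> p ! (length p - 2))"
proof -
  have v: "vwalk (p @ [u]) (with_proj G) \<longleftrightarrow> vwalk p (with_proj G) \<and> (last p, u) \<in> parcs G"
    using assms pair_wf_digraph.in_arcsD2[OF assms(1)]
    by (auto simp: vwalk_def set_vwalk_arcs_snoc)
  have b: "(\<forall>i. i + 2 < length (p @ [u]) \<longrightarrow> (p @ [u]) ! i \<noteq> (p @ [u]) ! (i + 2)) \<longleftrightarrow>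
    (\<forall>i. i + 2 < length p \<longrightarrow> p ! i \<noteq> p ! (i + 2)) \<and>
    (length p \<ge> 2 \<longrightarrow> u \<noteq> p ! (length p - 2))" (is "?L \<longleftrightarrow> ?R1 \<and> ?R2")
  proof (intro iffI conjI)
    assume L: ?L
    show ?R1
    proof (intro allI impI)
      fix i assume i: "i + 2 < length p"
      then show "p ! i \<noteq> p ! (i + 2)" using L[rule_format, of i] by (auto simp: nth_append)
    qed
    show ?R2
    proof
      assume l: "length p \<ge> 2"
      then have e: "length p - 2 + 2 = length p" by simp
      show "u \<noteq> p ! (length p - 2)"
        using L[rule_format, of "length p - 2"] l unfolding e
        by (cases "length p - 2 < length p") (auto simp: nth_append)
    qed
  next
    assume R: "?R1 \<and> ?R2"
    show ?L
    proof (intro allI impI)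
      fix i assume i: "i + 2 < length (p @ [u])"
      show "(p @ [u]) ! i \<noteq> (p @ [u]) ! (i + 2)"
      proof (cases "i + 2 < length p")
        case True then show ?thesis using R by (auto simp: nth_append)
      next
        case False
        then have l: "length p = i + 2" using i by simp
        then have "u \<noteq> p ! i" using R by auto
        then show ?thesis using l by (auto simp: nth_append)
      qed
    qed
  qed
  show ?thesis unfolding reduced_paths_def mem_Collect_eq v b using assms(2) by auto
qed

lemma reduced_paths_butlast:
  assumes "pair_wf_digraph G" "p \<in> reduced_paths G v\<^sub>0" "length p \<ge> 2"
  shows "butlast p \<in> reduced_paths G v\<^sub>0" "(last (butlast p), last p) \<in> parcs G"
    "last (butlast p) = p ! (length p - 2)"
proof -
  have b: "butlast p \<noteq> []" using assms(3) by (cases p rule: rev_cases) auto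
  have e: "butlast p @ [last p] = p" using assms(3) by (intro append_butlast_last_id) auto
  show "butlast p \<in> reduced_paths G v\<^sub>0" "(last (butlast p), last p) \<in> parcs G"
    using reduced_paths_snoc[OF assms(1) b, of "last p" v\<^sub>0] assms(2) unfolding e by auto
  show "last (butlast p) = p ! (length p - 2)"
    using b assms(3) by (simp add: last_conv_nth nth_butlast numeral_2_eq_2)
qed

lemma universal_cover_nbrs:
  assumes "pair_wf_digraph G" and p: "p \<in> reduced_paths G v\<^sub>0"
  shows "{p'. (p, p') \<in> parcs (universal_cover G v\<^sub>0)} =
    {p @ [u] | u. (last p, u) \<in> parcs G \<and> (length p \<ge> 2 \<longrightarrow> u \<noteq> p ! (length p - 2))} \<union>
    (if length p \<ge> 2 then {butlast p} else {})"
proof -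
  have ne: "p' \<noteq> []" if "p' \<in> reduced_paths G v\<^sub>0" for p'
    using that by (auto simp: reduced_paths_def)
  have "(\<exists>u. p = p' @ [u]) \<and> p' \<in> reduced_paths G v\<^sub>0 \<longleftrightarrow> length p \<ge> 2 \<and> p' = butlast p" for p'
  proof
    assume "(\<exists>u. p = p' @ [u]) \<and> p' \<in> reduced_paths G v\<^sub>0"
    then show "length p \<ge> 2 \<and> p' = butlast p" using ne[of p'] by (cases p') auto
  next
    assume l: "length p \<ge> 2 \<and> p' = butlast p"
    then have "p = p' @ [last p]" using ne[OF p] by simp
    then show "(\<exists>u. p = p' @ [u]) \<and> p' \<in> reduced_paths G v\<^sub>0"
      using reduced_paths_butlast(1)[OF assms] l by blast
  qed
  then show ?thesis using p reduced_paths_snoc[OF assms(1) ne[OF p]]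
    by (auto simp: universal_cover_def)
qed

text \<open>The end point map is a bijection on stars, i.e. a covering of graphs.\<close>

lemma universal_cover_covering:
  assumes "pair_bidirected_digraph G" and p: "p \<in> pverts (universal_cover G v\<^sub>0)"
  shows "bij_betw last {p'. (p, p') \<in> parcs (universal_cover G v\<^sub>0)} {u. (last p, u) \<in> parcs G}"
proof -
  interpret pair_bidirected_digraph G by fact
  have wf: "pair_wf_digraph G" by unfold_locales
  have p: "p \<in> reduced_paths G v\<^sub>0" using p by (simp add: universal_cover_def)
  have sym: "(b, a) \<in> parcs G" if "(a, b) \<in> parcs G" for a b
    using pair_sym_arcs that by (auto simp: symmetric_def sym_def)
  show ?thesis
    unfolding universal_cover_nbrs[OF wf p] bij_betw_def
  proof
    show "inj_on last ({p @ [u] |u. (last p, u) \<in> parcs G \<and>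
        (2 \<le> length p \<longrightarrow> u \<noteq> p ! (length p - 2))} \<union> (if 2 \<le> length p then {butlast p} else {}))"
      using reduced_paths_butlast(3)[OF wf p] by (auto simp: inj_on_def)
    have "last ` {p @ [u] |u. (last p, u) \<in> parcs G \<and>
        (2 \<le> length p \<longrightarrow> u \<noteq> p ! (length p - 2))} =
      {u. (last p, u) \<in> parcs G \<and> (2 \<le> length p \<longrightarrow> u \<noteq> p ! (length p - 2))}"
      by (force simp: image_iff)
    then show "last ` ({p @ [u] |u. (last p, u) \<in> parcs G \<and>
        (2 \<le> length p \<longrightarrow> u \<noteq> p ! (length p - 2))} \<union> (if 2 \<le> length p then {butlast p} else {}))
      = {u. (last p, u) \<in> parcs G}"
      unfolding image_Un using reduced_paths_butlast[OF wf p] sym by auto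
  qed
qed

text \<open>The covering graph is a tree. (\<open>cycle\<close> admits the back-and-forth walk along a single edge.)\<close>

lemma universal_cover_connected:
  assumes "pair_wf_digraph G" and "p \<in> pverts (universal_cover G v\<^sub>0)"
  shows "[v\<^sub>0] \<rightarrow>\<^sup>*\<^bsub>with_proj (universal_cover G v\<^sub>0)\<^esub> p"
proof -
  have wf: "pair_wf_digraph (universal_cover G v\<^sub>0)"
    by unfold_locales (auto simp: universal_cover_def)
  interpret C: pair_wf_digraph "universal_cover G v\<^sub>0" by fact
  have "p \<in> reduced_paths G v\<^sub>0" using assms(2) by (simp add: universal_cover_def)
  then show ?thesis
  proof (induction p rule: rev_induct)
    case Nil then show ?case by (auto simp: reduced_paths_def)
  next
    case (snoc u p)
    show ?case
    proof (cases "p = []")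
      case True
      then have "p @ [u] = [v\<^sub>0]" using snoc.prems by (auto simp: reduced_paths_def)
      moreover have "p @ [u] \<in> pverts (universal_cover G v\<^sub>0)"
        using snoc.prems by (simp add: universal_cover_def)
      ultimately show ?thesis using C.reachable_refl by metis
    next
      case False
      then have q: "p \<in> reduced_paths G v\<^sub>0"
        using snoc.prems reduced_paths_snoc[OF assms(1)] by blast
      have "(p, p @ [u]) \<in> parcs (universal_cover G v\<^sub>0)"
        using q snoc.prems by (auto simp: universal_cover_def)
      then show ?thesis using snoc.IH[OF q] C.reachable_adj_trans by auto
    qed
  qed
qed

lemma universal_cover_acyclic:
  assumes "pre_digraph.cycle (with_proj (universal_cover G v\<^sub>0)) c"
  shows "length c \<le> 2"
proof (rule ccontr)
  assume n: "\<not> length c \<le> 2"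
  interpret C: pair_wf_digraph "universal_cover G v\<^sub>0"
    by unfold_locales (auto simp: universal_cover_def)
  from assms obtain w where w: "C.awalk w c w" "distinct (tl (pawalk_verts w c))"
    by (auto simp: C.cycle_def)
  define y where "y = (\<lambda>i. pawalk_verts w c ! i)"
  have walk: "length (pawalk_verts a d) = Suc (length d) \<and> pawalk_verts a d ! 0 = a \<and>
      pawalk_verts a d ! length d = b \<and>
      (\<forall>i<length d. (pawalk_verts a d ! i, pawalk_verts a d ! Suc i) \<in> set d)"
    if "pcas a d b" for a b d
    using that
  proof (induction d arbitrary: a)
    case (Cons e d)
    then show ?case by (cases e) (auto simp: nth_Cons split: nat.splits)
  qed simp
  have W: "length (pawalk_verts w c) = Suc (length c)" "y 0 = w" "y (length c) = w"
    using walk[of w c w] w(1) unfolding y_def C.awalk_def by auto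
  have E: "(y i, y (Suc i)) \<in> parcs (universal_cover G v\<^sub>0)" if "i < length c" for i
    using walk[of w c w] w(1) that unfolding y_def C.awalk_def by auto
  have inj: "i = j" if "y (Suc i) = y (Suc j)" "i < length c" "j < length c" for i j
    using w(2) W(1) that by (simp add: y_def nth_tl distinct_conv_nth) metis
  have parent: "p' = butlast p"
    if "(p, p') \<in> parcs (universal_cover G v\<^sub>0) \<or> (p', p) \<in> parcs (universal_cover G v\<^sub>0)"
      and "length p' \<le> length p" for p p'
    using that by (auto simp: universal_cover_def)
  define L where "L = Max ((\<lambda>i. length (y (Suc i))) ` {..<length c})"
  have "L \<in> (\<lambda>i. length (y (Suc i))) ` {..<length c}"
    unfolding L_def using n by (intro Max_in) (auto simp: lessThan_empty_iff bot_nat_def)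
  then obtain m where m: "m < length c" "length (y (Suc m)) = L" by auto
  have max: "length (y (Suc i)) \<le> L" if "i < length c" for i
    unfolding L_def using that by (intro Max_ge) auto
  have max': "length (y i) \<le> L" if "i \<le> length c" for i
  proof (cases i)
    case 0
    have "Suc (length c - 1) = length c" using n by simp
    then show ?thesis using max[of "length c - 1"] 0 W by simp
  next
    case (Suc k)
    then show ?thesis using max[of k] that by simp
  qed
  define s where "s = (if Suc m = length c then 0 else Suc m)"
  have s: "s < length c" "y s = y (Suc m)" using m W by (auto simp: s_def)
  have "y m = butlast (y (Suc m))"
    using parent[of "y (Suc m)" "y m"] E[OF m(1)] max'[of m] m by auto
  moreover have "y (Suc s) = butlast (y (Suc m))"
    using parent[of "y (Suc m)" "y (Suc s)"] E[OF s(1)] max'[of "Suc s"] m s by auto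
  ultimately have eq: "y m = y (Suc s)" by simp
  show False
  proof (cases m)
    case 0
    have l: "Suc (length c - 1) = length c" "length c - 1 < length c" using n by linarith+
    have "y (Suc (length c - 1)) = y (Suc s)" using eq 0 W l(1) by simp
    from inj[OF this l(2) s(1)] have "length c - 1 = s" .
    moreover have "s = 1" using 0 n by (simp add: s_def)
    ultimately show False using n by linarith
  next
    case (Suc k)
    have "y (Suc k) = y (Suc s)" using eq Suc by simp
    from inj[OF this _ s(1)] have "k = s" using Suc m(1) by simp
    then show False using Suc n unfolding s_def by (simp split: if_splits)
  qed
qed

end

theory Submission
  imports Defs
begin

text \<open>
  Conjugating \<open>\<Sum>\<tau> = 0\<close> at a vertex \<open>a\<close> and dividing \<open>\<Sum>q = 0\<close> by \<open>\<i>\<close> gives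
  \<open>\<Sum>\<^sub>b cnj \<tau>(a,b) = 0\<close> and \<open>\<Sum>\<^sub>b cnj \<tau>(a,b) (g\<^sub>b - g\<^sub>a) = 0\<close>, hence also
  \<open>\<Sum>\<^sub>b cnj \<tau>(a,b) g\<^sub>b = 0\<close>. For fixed \<open>a\<close> the three components of the Weierstrass vector are
  affine functions of \<open>g\<^sub>b\<close>, so \<open>\<Sum>\<^sub>b dF(a,b) = 0\<close> (\<open>sum_dF_star\<close>): this is the balancing condition,
  already before real parts are taken. Moreover \<open>dF\<close> is antisymmetric, because \<open>\<tau>\<close> is and the
  Weierstrass vector is symmetric in \<open>a\<close> and \<open>b\<close>.

  The rest is integration of an antisymmetric function \<open>\<omega>\<close> on oriented edges. A vertex of the
  universal cover is itself a reduced path, so summing \<open>\<omega>\<close> along it is a primitive of the lifted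
  form (\<open>integrates_universal_cover\<close>), the only one up to the value at the base vertex. The end
  point map is bijective on stars, and so carries both the valency and the balancing condition
  from \<open>M\<close> to the cover (\<open>bij_betw_universal_cover_star\<close>). On \<open>M\<close> itself, vanishing around cycles
  implies vanishing around all closed walks (\<open>sum_closed_walk_eq_0\<close>), since a nonempty closed walk that is
  not a cycle splits into two shorter ones; then sums along walks depend on the end points only
  and define a primitive on each component (\<open>ex_integrates\<close>).
\<close>

section \<open>The Weierstrass form\<close>

lemma dF_eq_quadratic_differential:
  assumes "q e = \<i> * cnj (\<tau> e) * dg z g e" and "dg z g e \<noteq> 0"
  shows "dF z g \<tau> e = (\<i> * q e / dg z g e) *s weierstrass_vector z g e"
proof -
  have "\<i> * q e / dg z g e = - cnj (\<tau> e)"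
    using assms by (simp add: field_simps)
  then show ?thesis by (simp add: dF_def)
qed

lemma dF_reverse:
  assumes "\<tau> (b, a) = - \<tau> (a, b)"
  shows "dF z g \<tau> (b, a) = - dF z g \<tau> (a, b)"
  using assms by (simp add: dF_def weierstrass_vector_def vec_eq_iff forall_3 vector_3 algebra_simps)

text \<open>
  In the application \<open>S\<close> is the star of \<open>a\<close>. Every component of \<open>dF\<close> on \<open>S\<close> is a combination of
  \<open>cnj \<tau>\<close> and \<open>cnj \<tau> * g\<^sub>b\<close> with coefficients that depend on \<open>a\<close> only, and the two closing
  conditions say exactly that these two functions have sum zero over \<open>S\<close>.
\<close>

lemma sum_dF_star:
  fixes S :: "('v \<times> 'v) set"
  assumes q: "\<And>e. e \<in> S \<Longrightarrow> q e = \<i> * cnj (\<tau> e) * dg z g e"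
    and origin: "\<And>e. e \<in> S \<Longrightarrow> fst e = a"
    and "sum q S = 0" and "sum \<tau> S = 0"
  shows "sum (dF z g \<tau>) S = 0"
proof -
  define t where "t = (\<lambda>e. cnj (\<tau> e))"
  define h where "h = (\<lambda>e :: 'v \<times> 'v. g (z (snd e)))"
  have t: "sum t S = 0"
    using arg_cong[OF assms(4), of cnj] by (simp add: t_def)
  have "sum q S = (\<Sum>e\<in>S. \<i> * (t e * h e - g (z a) * t e))"
  proof (rule sum.cong[OF refl])
    fix e assume e: "e \<in> S"
    then have "e = (a, snd e)" using origin by (metis prod.collapse)
    then have "dg z g e = h e - g (z a)" unfolding dg_def h_def by (metis case_prod_conv)
    then show "q e = \<i> * (t e * h e - g (z a) * t e)"
      unfolding q[OF e] by (simp only: t_def) (simp add: algebra_simps)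
  qed
  also have "\<dots> = \<i> * ((\<Sum>e\<in>S. t e * h e) - g (z a) * sum t S)"
    by (simp add: sum_distrib_left[symmetric] sum_subtractf)
  finally have th: "(\<Sum>e\<in>S. t e * h e) = 0" using assms(3) t by simp
  \<comment> \<open>\<open>A i + B i * g\<^sub>b\<close> is the \<open>i\<close>-th component of the Weierstrass vector of \<open>(a, b)\<close>.\<close>
  define A :: "complex ^ 3" where "A = vector [1, \<i>, g (z a)]"
  define B :: "complex ^ 3" where "B = vector [- g (z a), \<i> * g (z a), 1]"
  have "dF z g \<tau> e $ i = - (A $ i * t e + B $ i * (t e * h e))" if "e \<in> S" for e i
  proof -
    obtain b where e: "e = (a, b)" using origin[OF \<open>e \<in> S\<close>] by (metis prod.collapse)
    have "\<forall>i. dF z g \<tau> (a, b) $ i = - (A $ i * t (a, b) + B $ i * (t (a, b) * h (a, b)))"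
      unfolding forall_3 by (simp add: dF_def weierstrass_vector_def A_def B_def t_def h_def vector_3
          algebra_simps)
    then show ?thesis using e by blast
  qed
  then have "(\<Sum>e\<in>S. dF z g \<tau> e $ i) = - (A $ i * sum t S + B $ i * (\<Sum>e\<in>S. t e * h e))" for i
    by (simp add: sum_negf sum_subtractf sum_distrib_left)
  then show ?thesis using t th by (simp add: vec_eq_iff sum_component)
qed

lemma Re_vec_minus: "Re_vec (- w) = - Re_vec w"
  by (simp add: Re_vec_def vec_eq_iff)

lemma Re_vec_sum: "Re_vec (sum f S) = (\<Sum>e\<in>S. Re_vec (f e))"
  by (simp add: Re_vec_def vec_eq_iff)

section \<open>Primitives of forms on graphs\<close>

lemma harmonic_realizationI:
  assumes "trivalent_graph G" and "integrates G \<omega> X"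
    and "\<And>v. v \<in> pverts G \<Longrightarrow> sum \<omega> (out_arcs G v) = 0"
  shows "harmonic_realization G X"
proof -
  have "(\<Sum>(a, b)\<in>out_arcs G v. X b - X a) = sum \<omega> (out_arcs G v)" for v
    using assms(2) by (intro sum.cong) (auto simp: integrates_def)
  then show ?thesis using assms by (simp add: harmonic_realization_def)
qed

lemma (in pair_wf_digraph) integrates_awalk:
  assumes "integrates G \<omega> X" and "awalk u c v"
  shows "X v = X u + sum_list (map \<omega> c)"
  using assms(2)
proof (induction c arbitrary: u)
  case Nil
  then show ?case by (simp add: awalk_Nil_iff)
next
  case (Cons e c)
  then have e: "e \<in> parcs G" "u = fst e" and c: "awalk (snd e) c v"
    by (auto simp: awalk_Cons_iff)
  have "X (snd e) - X (fst e) = \<omega> e"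
    using assms(1) e(1) by (cases e) (auto simp: integrates_def)
  then show ?case using Cons.IH[OF c] e(2) by (simp add: algebra_simps)
qed

text \<open>
  Some vertex repeats along a nonempty closed walk that is not a cycle. Cutting out the part between
  two visits leaves two shorter closed walks.
\<close>

lemma (in wf_digraph) sum_closed_walk_eq_0:
  fixes \<omega> :: "'b \<Rightarrow> 'c::ab_group_add"
  assumes cycles: "\<And>c. cycle c \<Longrightarrow> sum_list (map \<omega> c) = 0"
    and "awalk u c u"
  shows "sum_list (map \<omega> c) = 0"
  using assms(2)
proof (induction "length c" arbitrary: u c rule: less_induct)
  case less
  show ?case
  proof (cases c)
    case Nil
    then show ?thesis by simp
  next
    case (Cons e es)
    have e: "awalk u [e] (head G e)" and es: "awalk (head G e) es u"
      using less.prems Cons by (auto simp: awalk_Cons_iff awalk_Nil_iff)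
    show ?thesis
    proof (cases "distinct (awalk_verts (head G e) es)")
      case True
      then have "cycle c" using less.prems Cons by (auto simp: cycle_def)
      then show ?thesis by (rule cycles)
    next
      case False
      obtain p r s w where d: "es = p @ r @ s" "0 < length r"
        and w: "awalk (head G e) p w" "awalk w r w" "awalk w s u"
        using awalk_not_distinct_decomp[OF es False] by blast
      have "awalk u ([e] @ p @ s) u" using e w by (intro awalk_appendI)
      then have "sum_list (map \<omega> ([e] @ p @ s)) = 0"
        using less.hyps[of "[e] @ p @ s" u] d Cons by simp
      moreover have "sum_list (map \<omega> r) = 0"
        using less.hyps[of r w] w d Cons by simp
      ultimately show ?thesis using d Cons by (simp add: algebra_simps)
    qed
  qed
qed

lemma (in sym_digraph) sum_awalk_unique:
  fixes \<omega> :: "'b \<Rightarrow> 'c::ab_group_add"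
  assumes cycles: "\<And>c. cycle c \<Longrightarrow> sum_list (map \<omega> c) = 0"
    and c: "awalk u c v" and d: "awalk u d v"
  shows "sum_list (map \<omega> c) = sum_list (map \<omega> d)"
proof -
  \<comment> \<open>A common return walk closes both.\<close>
  have "v \<rightarrow>\<^sup>*\<^bsub>G\<^esub> u" using symmetric_reachable'[OF reachable_awalkI[OF c]] .
  then obtain s where s: "awalk v s u" by (auto simp: reachable_awalk)
  have "sum_list (map \<omega> (c @ s)) = 0" "sum_list (map \<omega> (d @ s)) = 0"
    using awalk_appendI[OF c s] awalk_appendI[OF d s]
    by (blast intro: sum_closed_walk_eq_0[where \<omega> = \<omega>, OF cycles])+
  then show ?thesis by (metis add_right_cancel map_append sum_list_append)
qed

text \<open>
  The primitive is the sum along any walk from the base vertex of the component. An edge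
  \<open>(a, b)\<close> prolongs the walk chosen for \<open>a\<close> to one for \<open>b\<close>, and path independence compares it
  with the walk chosen for \<open>b\<close>.
\<close>

lemma (in pair_sym_digraph) ex_integrates:
  assumes cycles: "\<And>c. cycle c \<Longrightarrow> sum_list (map \<omega> c) = 0"
  shows "\<exists>X. integrates G \<omega> X"
proof -
  \<comment> \<open>\<open>r\<close> picks a base vertex in each connected component.\<close>
  define r where "r = (\<lambda>v. SOME u. v \<rightarrow>\<^sup>*\<^bsub>with_proj G\<^esub> u)"
  define w where "w = (\<lambda>v. SOME c. awalk (r v) c v)"
  define X where "X = (\<lambda>v. sum_list (map \<omega> (w v)))"
  have w: "awalk (r v) (w v) v" if "v \<in> pverts G" for v
  proof -
    have "v \<rightarrow>\<^sup>*\<^bsub>with_proj G\<^esub> v" using that by simp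
    then have "v \<rightarrow>\<^sup>*\<^bsub>with_proj G\<^esub> r v" unfolding r_def by (rule someI)
    then have "r v \<rightarrow>\<^sup>*\<^bsub>with_proj G\<^esub> v" by (rule symmetric_reachable')
    then obtain c where "awalk (r v) c v" by (auto simp: reachable_awalk)
    then show ?thesis unfolding w_def by (rule someI)
  qed
  have "X b - X a = \<omega> (a, b)" if ab: "(a, b) \<in> parcs G" for a b
  proof -
    have a: "a \<in> pverts G" and b: "b \<in> pverts G" using ab by (auto dest: wellformed')
    have e: "awalk a [(a, b)] b" using arc_implies_awalk[of "(a, b)"] ab by simp
    have ab': "a \<rightarrow>\<^sup>*\<^bsub>with_proj G\<^esub> b" using reachable_awalkI[OF e] .
    have "a \<rightarrow>\<^sup>*\<^bsub>with_proj G\<^esub> u \<longleftrightarrow> b \<rightarrow>\<^sup>*\<^bsub>with_proj G\<^esub> u" for u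
      using ab' symmetric_reachable'[OF ab'] by (blast intro: reachable_trans)
    then have "r a = r b" unfolding r_def by presburger
    then have "awalk (r b) (w a @ [(a, b)]) b"
      using awalk_appendI[OF w[OF a] e] by simp
    from sum_awalk_unique[where \<omega> = \<omega>, OF cycles w[OF b] this]
    have "X b = X a + \<omega> (a, b)" by (simp add: X_def)
    then show ?thesis by simp
  qed
  then show ?thesis unfolding integrates_def by blast
qed

section \<open>The universal covering graph\<close>

text \<open>
  The covering property, stated for oriented edges instead of neighbours, so that it transports
  cardinalities and sums over stars.
\<close>

lemma bij_betw_universal_cover_star:
  assumes "pair_bidirected_digraph G" and p: "p \<in> pverts (universal_cover G v\<^sub>0)"
  shows "bij_betw (map_prod last last) (out_arcs (universal_cover G v\<^sub>0) p) (out_arcs G (last p))"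
proof -
  have star: "out_arcs H a = Pair a ` {b. (a, b) \<in> parcs H}" for H :: "'x pair_pre_digraph" and a
    by (auto simp: out_arcs_def)
  show ?thesis
    using universal_cover_covering[OF assms] unfolding star
    by (auto simp: bij_betw_def inj_on_def image_image image_iff Ball_def)
qed

lemma trivalent_universal_cover:
  assumes "trivalent_graph G"
  shows "trivalent_graph (universal_cover G v\<^sub>0)"
proof -
  have G: "pair_bidirected_digraph G" using assms by (simp add: trivalent_graph_def)
  have "pair_bidirected_digraph (universal_cover G v\<^sub>0)"
    by unfold_locales (auto simp: universal_cover_def symmetric_def sym_def)
  moreover have "out_degree (universal_cover G v\<^sub>0) p = 3"
    if p: "p \<in> pverts (universal_cover G v\<^sub>0)" for p
  proof -
    have "last p \<in> pverts G"
      using p by (auto simp: universal_cover_def reduced_paths_def vwalk_def)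
    then show ?thesis
      using bij_betw_same_card[OF bij_betw_universal_cover_star[OF G p]] assms
      by (simp add: trivalent_graph_def out_degree_def)
  qed
  ultimately show ?thesis by (simp add: trivalent_graph_def)
qed

lemma sum_lift_form_star:
  assumes "pair_bidirected_digraph G" and "p \<in> pverts (universal_cover G v\<^sub>0)"
  shows "sum (lift_form \<omega>) (out_arcs (universal_cover G v\<^sub>0) p) = sum \<omega> (out_arcs G (last p))"
  using sum.reindex_bij_betw[OF bij_betw_universal_cover_star[OF assms], of \<omega>]
  by (simp add: lift_form_def map_prod_def case_prod_unfold)

lemma vwalk_arcs_snoc:
  assumes "p \<noteq> []"
  shows "vwalk_arcs (p @ [u]) = vwalk_arcs p @ [(last p, u)]"
  using assms by (simp add: vwalk_arcs_append)

text \<open>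
  Adjacent vertices of the cover are paths of which one extends the other by an edge. If the
  edge is removed rather than added, the difference of the two sums has the opposite sign, and
  antisymmetry of \<open>\<omega>\<close> identifies it with the value on the reversed edge.
\<close>

lemma integrates_universal_cover:
  assumes "pair_wf_digraph G"
    and antisym: "\<And>a b. (a, b) \<in> parcs G \<Longrightarrow> \<omega> (b, a) = - \<omega> (a, b)"
  shows "integrates (universal_cover G v\<^sub>0) (lift_form \<omega>) (\<lambda>p. sum_list (map \<omega> (vwalk_arcs p)))"
proof -
  have snoc: "p \<noteq> []" "(last p, u) \<in> parcs G"
    if "p \<in> reduced_paths G v\<^sub>0" "p @ [u] \<in> reduced_paths G v\<^sub>0" for p u
  proof -
    show "p \<noteq> []" using that(1) by (auto simp: reduced_paths_def)
    then show "(last p, u) \<in> parcs G" using that(2) reduced_paths_snoc[OF assms(1)] by blast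
  qed
  show ?thesis
    unfolding integrates_def
    by (auto simp: universal_cover_def lift_form_def vwalk_arcs_snoc snoc antisym)
qed

text \<open>
  Every reduced path arises from \<open>[v\<^sub>0]\<close> by adding one edge at a time, and its initial segments
  are reduced, so the value at \<open>[v\<^sub>0]\<close> propagates along the cover.
\<close>

lemma integrates_universal_cover_unique:
  assumes "pair_wf_digraph G"
    and X: "integrates (universal_cover G v\<^sub>0) (lift_form \<omega>) X"
    and "p \<in> reduced_paths G v\<^sub>0"
  shows "X p = X [v\<^sub>0] + sum_list (map \<omega> (vwalk_arcs p))"
  using assms(3)
proof (induction p rule: rev_induct)
  case Nil
  then show ?case by (simp add: reduced_paths_def vwalk_def)
next
  case (snoc u p)
  show ?case
  proof (cases "p = []")
    case True
    then show ?thesis using snoc.prems by (simp add: reduced_paths_def)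
  next
    case False
    then have p: "p \<in> reduced_paths G v\<^sub>0"
      using snoc.prems reduced_paths_snoc[OF assms(1)] by blast
    then have "(p, p @ [u]) \<in> parcs (universal_cover G v\<^sub>0)"
      using snoc.prems by (simp add: universal_cover_def)
    then have "X (p @ [u]) - X p = \<omega> (last p, u)"
      using X by (auto simp: integrates_def lift_form_def)
    then show ?thesis using snoc.IH[OF p] False by (simp add: vwalk_arcs_snoc algebra_simps)
  qed
qed

section \<open>The discrete harmonic surface\<close>

theorem theorem6p2:
  fixes M :: "'v pair_pre_digraph"
    and z :: "'v \<Rightarrow> complex"
    and g :: "complex \<Rightarrow> complex"
    and q \<tau> :: "'v \<times> 'v \<Rightarrow> complex"
  defines "\<omega> \<equiv> \<lambda>e. Re_vec (dF z g \<tau> e)"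
  assumes "trivalent_plane_graph M z"
    and "g holomorphic_on UNIV"
    and "holomorphic_quadratic_differential M z g q \<tau>"
  shows
    "(\<forall>e\<in>parcs M. dg z g e \<noteq> 0 \<longrightarrow>
        dF z g \<tau> e = (\<i> * q e / dg z g e) *s weierstrass_vector z g e) \<and>
     (\<forall>v\<^sub>0\<in>pverts M.
        (\<exists>X. integrates (universal_cover M v\<^sub>0) (lift_form \<omega>) X) \<and>
        (\<forall>X. integrates (universal_cover M v\<^sub>0) (lift_form \<omega>) X \<longrightarrow>
             harmonic_realization (universal_cover M v\<^sub>0) X \<and>
             (\<forall>p\<in>pverts (universal_cover M v\<^sub>0).
                X p = X [v\<^sub>0] + sum_list (map \<omega> (vwalk_arcs p))))) \<and>
     ((\<forall>c. pre_digraph.cycle (with_proj M) c \<longrightarrow> sum_list (map \<omega> c) = 0) \<longrightarrow>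
        (\<exists>X. integrates M \<omega> X) \<and>
        (\<forall>X. integrates M \<omega> X \<longrightarrow>
             harmonic_realization M X \<and>
             (\<forall>u c v. pre_digraph.awalk (with_proj M) u c v \<longrightarrow>
                X v = X u + sum_list (map \<omega> c))))"
proof -
  have M: "trivalent_graph M" using assms(2) by (simp add: trivalent_plane_graph_def)
  then have bi: "pair_bidirected_digraph M" by (simp add: trivalent_graph_def)
  interpret pair_bidirected_digraph M by fact
  have wf: "pair_wf_digraph M" by unfold_locales
  have q: "q e = \<i> * cnj (\<tau> e) * dg z g e" if "e \<in> parcs M" for e
    using assms(4) that by (simp add: holomorphic_quadratic_differential_def)
  have antisym: "\<omega> (b, a) = - \<omega> (a, b)" if "(a, b) \<in> parcs M" for a b
  proof -
    have "\<tau> (b, a) = - \<tau> (a, b)"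
      using assms(4) that
      by (auto simp: holomorphic_quadratic_differential_def discrete_one_form_def)
    then show ?thesis
      unfolding \<omega>_def by (subst dF_reverse) (simp_all add: Re_vec_minus)
  qed
  have balanced: "sum \<omega> (out_arcs M v) = 0" if "v \<in> pverts M" for v
  proof -
    have "sum (dF z g \<tau>) (out_arcs M v) = 0"
      using assms(4) that q
      by (intro sum_dF_star[where a = v and q = q])
        (auto simp: holomorphic_quadratic_differential_def)
    then show ?thesis
      unfolding \<omega>_def by (simp add: Re_vec_sum[symmetric]) (simp add: Re_vec_def vec_eq_iff)
  qed
  have end_in: "last p \<in> pverts M" if "p \<in> pverts (universal_cover M v\<^sub>0)" for p v\<^sub>0
    using that by (auto simp: universal_cover_def reduced_paths_def vwalk_def)
  have cover_ex: "\<exists>X. integrates (universal_cover M v\<^sub>0) (lift_form \<omega>) X" for v\<^sub>0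
    using integrates_universal_cover[where \<omega> = \<omega>, OF wf antisym] by blast
  have cover_harm: "harmonic_realization (universal_cover M v\<^sub>0) X \<and>
      (\<forall>p\<in>pverts (universal_cover M v\<^sub>0). X p = X [v\<^sub>0] + sum_list (map \<omega> (vwalk_arcs p)))"
    if X: "integrates (universal_cover M v\<^sub>0) (lift_form \<omega>) X" for v\<^sub>0 X
  proof
    show "harmonic_realization (universal_cover M v\<^sub>0) X"
      by (rule harmonic_realizationI[OF trivalent_universal_cover[OF M] X])
        (simp add: sum_lift_form_star[OF bi] balanced end_in)
    show "\<forall>p\<in>pverts (universal_cover M v\<^sub>0). X p = X [v\<^sub>0] + sum_list (map \<omega> (vwalk_arcs p))"
      using integrates_universal_cover_unique[OF wf X] by (simp add: universal_cover_def)
  qed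
  have ex: "\<exists>X. integrates M \<omega> X"
    if "\<forall>c. cycle c \<longrightarrow> sum_list (map \<omega> c) = 0"
    using that ex_integrates[of \<omega>] by blast
  have harm: "harmonic_realization M X \<and>
      (\<forall>u c v. awalk u c v \<longrightarrow> X v = X u + sum_list (map \<omega> c))"
    if "integrates M \<omega> X" for X
    using harmonic_realizationI[OF M that balanced] integrates_awalk[OF that] by blast
  have formula: "\<forall>e\<in>parcs M. dg z g e \<noteq> 0 \<longrightarrow>
      dF z g \<tau> e = (\<i> * q e / dg z g e) *s weierstrass_vector z g e"
    using dF_eq_quadratic_differential q by blast
  show ?thesis
    using formula cover_ex cover_harm ex harm by (intro conjI ballI impI allI) simp_all
qed

end
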